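(* Let $G$ be a (discrete) group and let $\mu$ be a finitely supported non-degenerate probability distribution on $G$. Then $G$ admits a $\mu$-stationary conditional probability.
   Context: A probability distribution $\mu$ on a group $G$ is non-degenerate if its support generates $G$ as a semigroup. A conditional probability on a set $X$ (without measurability constraints) assigns a value $P(A|B)\in[0,1]$ to all subsets $A\subseteq B\subseteq X$ with $B\neq\varnothing$, such that $P(\cdot|B)$ is a finitely additive probability measure on (all subsets of) $B$ and $P(A|B)\,P(B|C)=P(A|C)$ for all $A\subseteq B\subseteq C$ with $B\neq\varnothing$. A conditional probability on $G$ refers to the case $X=G$. It is $\mu$-stationary if $P(\mu*\cdot\,|\,\cdot)=P(\cdot|\cdot)$ holds whenever defined, where $\mu*f=\sum_{g\in G}\mu(g)\,gf$ with $(gf)(x)=f(g^{-1}x)$ and sets are identified with their indicator functions (so that $g\mathbf 1_A=\mathbf 1_{gA}$), $P(\cdot|B)$ being extended to functions with finitely many values supported in $B$ by linearity. Explicitly: $\sum_{g\in G}\mu(g)\,P(gA|B)=P(A|B)$ for all $A\subseteq B\subseteq G$ with $B\neq\varnothing$ and $gA\subseteq B$ for every $g$ in the support of $\mu$. *)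

theory Defs
  imports "HOL-Probability.Probability_Mass_Function" "HOL-Algebra.Coset"
begin

inductive_set semigroup_generated :: "('a, 'b) monoid_scheme \<Rightarrow> 'a set \<Rightarrow> 'a set"
  for G and S where
  base: "s \<in> S \<Longrightarrow> s \<in> semigroup_generated G S"
| mult: "x \<in> semigroup_generated G S \<Longrightarrow> y \<in> semigroup_generated G S
    \<Longrightarrow> x \<otimes>\<^bsub>G\<^esub> y \<in> semigroup_generated G S"

text \<open>A probability distribution on the group \<open>G\<close> is a \<open>pmf\<close> on the underlying type
  whose support lies in \<open>carrier G\<close>.\<close>

definition distribution_on :: "('a, 'b) monoid_scheme \<Rightarrow> 'a pmf \<Rightarrow> bool" where
  "distribution_on G \<mu> \<longleftrightarrow> set_pmf \<mu> \<subseteq> carrier G"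

definition nondegenerate :: "('a, 'b) monoid_scheme \<Rightarrow> 'a pmf \<Rightarrow> bool" where
  "nondegenerate G \<mu> \<longleftrightarrow> semigroup_generated G (set_pmf \<mu>) = carrier G"

definition fin_additive_probability :: "'a set \<Rightarrow> ('a set \<Rightarrow> real) \<Rightarrow> bool" where
  "fin_additive_probability B m \<longleftrightarrow>
     (\<forall>A. A \<subseteq> B \<longrightarrow> m A \<in> {0..1}) \<and> m B = 1 \<and>
     (\<forall>A A'. A \<subseteq> B \<and> A' \<subseteq> B \<and> A \<inter> A' = {} \<longrightarrow> m (A \<union> A') = m A + m A')"

text \<open>Here \<open>P A B\<close> stands for \<open>P(A|B)\<close>. Only the values with \<open>A \<subseteq> B \<subseteq> X\<close> and \<open>B\<close> nonempty
  are meaningful; all others are left unconstrained.\<close>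

definition conditional_probability :: "'a set \<Rightarrow> ('a set \<Rightarrow> 'a set \<Rightarrow> real) \<Rightarrow> bool" where
  "conditional_probability X P \<longleftrightarrow>
     (\<forall>B. B \<subseteq> X \<and> B \<noteq> {} \<longrightarrow> fin_additive_probability B (\<lambda>A. P A B)) \<and>
     (\<forall>A B C. A \<subseteq> B \<and> B \<subseteq> C \<and> C \<subseteq> X \<and> B \<noteq> {} \<longrightarrow> P A B * P B C = P A C)"

text \<open>The equation \<open>P(\<mu> * 1\<^sub>A | B) = P(A | B)\<close>, where \<open>\<mu> * 1\<^sub>A = (\<Sum>g. \<mu>(g) 1\<^bsub>gA\<^esub>)\<close>, is required whenever
  both sides are defined, i.e. whenever \<open>A\<close> and all \<open>gA\<close> with \<open>g\<close> in the support of \<open>\<mu>\<close> are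
  contained in \<open>B\<close>. Terms with \<open>g\<close> outside the support vanish since \<open>pmf \<mu> g = 0\<close> there.\<close>

definition stationary ::
    "('a, 'b) monoid_scheme \<Rightarrow> 'a pmf \<Rightarrow> ('a set \<Rightarrow> 'a set \<Rightarrow> real) \<Rightarrow> bool" where
  "stationary G \<mu> P \<longleftrightarrow>
     (\<forall>A B. A \<subseteq> B \<and> B \<subseteq> carrier G \<and> B \<noteq> {} \<and> (\<forall>g\<in>set_pmf \<mu>. g <#\<^bsub>G\<^esub> A \<subseteq> B) \<longrightarrow>
        (\<Sum>\<^sub>\<infinity>g\<in>carrier G. pmf \<mu> g * P (g <#\<^bsub>G\<^esub> A) B) = P A B)"

end

theory Submission imports Defs begin

text \<open>Fix a nonempty set \<open>U\<close> and finitely many instances \<open>A\<close> of stationarity inside \<open>U\<close>, and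
  minimise the sum of the squared errors \<open>err m A\<close> over the compact convex set of finitely additive
  probabilities \<open>m\<close> on \<open>U\<close>. Comparing a minimiser with the point masses shows that, if the minimum
  were \<open>\<epsilon> > 0\<close>, the function \<open>f = (\<Sum>A. err m A * 1\<^sub>A)\<close> would be supported in \<open>U\<close> and satisfy
  \<open>f - \<mu> * f \<ge> \<epsilon>\<close> on \<open>U\<close>, which contradicts a minimum principle. By compactness every \<open>U\<close>
  carries a stationary finitely additive probability. For a finite family of conditioning sets these
  are assembled hierarchically, restricting from the union to the sets of positive mass and recursing
  on the null sets; a second compactness argument handles all conditioning sets at once.\<close>

section \<open>Finitely additive probabilities: compactness, convexity, null sets\<close>

text \<open>Tychonoff's theorem: function types carry the product topology, so closedness below
  refers to pointwise convergence.\<close>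

lemma compact_unit_cube: "compact (PiE UNIV (\<lambda>_. {0..1}) :: ('i \<Rightarrow> real) set)"
proof -
  have "compactin (product_topology (\<lambda>_::'i. euclideanreal) UNIV) (PiE UNIV (\<lambda>_. {0..1}))"
    by (simp add: compactin_PiE)
  then show ?thesis
    by (simp add: euclidean_product_topology)
qed

text \<open>Lets the closedness rules pass side conditions such as \<open>A \<subseteq> B\<close>,
  which do not mention the varying \<open>m\<close>.\<close>

lemma closed_Collect_const_imp:
  assumes "Q \<Longrightarrow> closed {m. R m}"
  shows "closed {m. Q \<longrightarrow> R m}"
  using assms by (cases Q) auto

lemma closed_fin_additive_probability: "closed {m. fin_additive_probability B m}"
  unfolding fin_additive_probability_def atLeastAtMost_iff
  by (intro closed_Collect_conj closed_Collect_all closed_Collect_const_imp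
      closed_Collect_eq closed_Collect_le continuous_on_const continuous_on_add
      continuous_on_product_coordinates)

text \<open>The cube also bounds the values of \<open>m\<close> at sets not contained in
  \<open>B\<close>, which \<open>fin_additive_probability\<close> leaves free.\<close>

lemma compact_fin_additive_probability:
  "compact (PiE UNIV (\<lambda>_. {0..1}) \<inter> {m. fin_additive_probability B m})"
  by (intro compact_Int_closed compact_unit_cube closed_fin_additive_probability)

lemma fin_additive_probability_indicator:
  assumes "x \<in> B"
  shows "fin_additive_probability B (\<lambda>A. indicator A x)"
  using assms by (auto simp: fin_additive_probability_def indicator_def)

lemma fin_additive_probability_convex:
  assumes "fin_additive_probability B m" "fin_additive_probability B m'" "0 \<le> t" "t \<le> 1"
  shows "fin_additive_probability B (\<lambda>A. (1 - t) * m A + t * m' A)"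
proof -
  have "0 \<le> (1 - t) * m A + t * m' A \<and> (1 - t) * m A + t * m' A \<le> 1" if "A \<subseteq> B" for A
    using assms that unfolding fin_additive_probability_def
    by (auto intro!: convex_bound_le)
  then show ?thesis
    using assms unfolding fin_additive_probability_def by (simp add: algebra_simps)
qed

lemma fin_additive_probability_nonneg:
  "fin_additive_probability B m \<Longrightarrow> A \<subseteq> B \<Longrightarrow> 0 \<le> m A"
  by (auto simp: fin_additive_probability_def)

lemma fin_additive_probability_Un:
  "fin_additive_probability B m \<Longrightarrow> A \<subseteq> B \<Longrightarrow> A' \<subseteq> B \<Longrightarrow> A \<inter> A' = {} \<Longrightarrow> m (A \<union> A') = m A + m A'"
  by (simp add: fin_additive_probability_def)

lemma fin_additive_probability_mono:
  assumes m: "fin_additive_probability U m" and "A \<subseteq> B" "B \<subseteq> U"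
  shows "m A \<le> m B"
proof -
  have "m (A \<union> (B - A)) = m A + m (B - A)"
    by (rule fin_additive_probability_Un[OF m]) (use assms in auto)
  moreover have "m (B - A) \<ge> 0"
    by (rule fin_additive_probability_nonneg[OF m]) (use assms in auto)
  moreover have "A \<union> (B - A) = B" using assms by auto
  ultimately show ?thesis by simp
qed

lemma fin_additive_probability_Union_null:
  assumes m: "fin_additive_probability U m"
    and "finite F" "\<And>B. B \<in> F \<Longrightarrow> B \<subseteq> U \<and> m B = 0"
  shows "m (\<Union>F) = 0"
  using assms(2,3)
proof (induction F rule: finite_induct)
  case empty
  show ?case using fin_additive_probability_Un[OF m, of "{}" "{}"] by simp
next
  case (insert B F)
  \<comment> \<open>Only the part of \<open>B\<close> not yet covered is added, since additivity
    needs disjoint sets.\<close>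
  have "m (\<Union>F \<union> (B - \<Union>F)) = m (\<Union>F) + m (B - \<Union>F)"
    by (rule fin_additive_probability_Un[OF m]) (use insert.prems in auto)
  moreover have "0 \<le> m (B - \<Union>F)"
    by (rule fin_additive_probability_nonneg[OF m]) (use insert.prems in auto)
  moreover have "m (B - \<Union>F) \<le> m B"
    by (rule fin_additive_probability_mono[OF m]) (use insert.prems in auto)
  moreover have "\<Union>(insert B F) = \<Union>F \<union> (B - \<Union>F)" by auto
  ultimately show ?case using insert by simp
qed

section \<open>Stationarity for one conditioning set\<close>

text \<open>The sum runs over the support only, so each instance involves finitely many coordinates
  of \<open>m\<close> when the support is finite.\<close>

definition stationary_on :: "('a, 'b) monoid_scheme \<Rightarrow> 'a pmf \<Rightarrow> 'a set \<Rightarrow> ('a set \<Rightarrow> real) \<Rightarrow> bool" where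
  "stationary_on G \<mu> B m \<longleftrightarrow>
     (\<forall>A. A \<subseteq> B \<and> (\<forall>g\<in>set_pmf \<mu>. g <#\<^bsub>G\<^esub> A \<subseteq> B) \<longrightarrow>
        (\<Sum>g\<in>set_pmf \<mu>. pmf \<mu> g * m (g <#\<^bsub>G\<^esub> A)) = m A)"

lemma stationary_iff_stationary_on:
  assumes "distribution_on G \<mu>" "finite (set_pmf \<mu>)"
  shows "stationary G \<mu> P \<longleftrightarrow>
    (\<forall>B. B \<subseteq> carrier G \<and> B \<noteq> {} \<longrightarrow> stationary_on G \<mu> B (\<lambda>A. P A B))"
proof -
  have "(\<Sum>\<^sub>\<infinity>g\<in>carrier G. pmf \<mu> g * h g) = (\<Sum>g\<in>set_pmf \<mu>. pmf \<mu> g * h g)" for h :: "'a \<Rightarrow> real"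
  proof -
    have "(\<Sum>\<^sub>\<infinity>g\<in>carrier G. pmf \<mu> g * h g) = (\<Sum>\<^sub>\<infinity>g\<in>set_pmf \<mu>. pmf \<mu> g * h g)"
      by (rule infsum_cong_neutral)
        (use assms(1) in \<open>auto simp: distribution_on_def set_pmf_iff\<close>)
    then show ?thesis by (simp add: assms(2))
  qed
  then show ?thesis
    unfolding stationary_def stationary_on_def by auto
qed

lemma closed_stationary_on:
  "closed {m. stationary_on G \<mu> B m}"
  unfolding stationary_on_def
  by (intro closed_Collect_all closed_Collect_const_imp closed_Collect_eq continuous_on_sum
      continuous_on_mult_left continuous_on_product_coordinates)

lemma stationary_on_cong:
  assumes "\<And>A. A \<subseteq> B \<Longrightarrow> m A = m' A"
  shows "stationary_on G \<mu> B m \<longleftrightarrow> stationary_on G \<mu> B m'"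
  using assms unfolding stationary_on_def by (simp cong: sum.cong)

lemma fin_additive_probability_cong:
  assumes "\<And>A. A \<subseteq> B \<Longrightarrow> m A = m' A"
  shows "fin_additive_probability B m \<longleftrightarrow> fin_additive_probability B m'"
  using assms unfolding fin_additive_probability_def by simp

text \<open>First-order optimality on a segment: with \<open>q\<close>, \<open>r\<close> squared
  norms of two vectors and \<open>d\<close> their inner product, the right-hand side is the squared
  norm at time \<open>t\<close>, with derivative \<open>2 * (d - q)\<close> at
  \<open>0\<close>.\<close>

lemma le_of_quadratic_min:
  fixes q d r :: real
  assumes "\<And>t. 0 < t \<Longrightarrow> t \<le> 1 \<Longrightarrow> q \<le> (1 - t)\<^sup>2 * q + 2 * t * (1 - t) * d + t\<^sup>2 * r"
  shows "q \<le> d"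
proof (rule ccontr)
  assume "\<not> q \<le> d"
  define a where "a = q - d"
  define s where "s = q - 2 * d + r"
  \<comment> \<open>Small enough that the second-order term \<open>t * s\<close> is at most
    \<open>a\<close>, hence below \<open>2 * a\<close>.\<close>
  define t where "t = a / (a + \<bar>s\<bar>)"
  have "a > 0" using \<open>\<not> q \<le> d\<close> by (simp add: a_def)
  then have t: "0 < t" "t \<le> 1" by (auto simp: t_def field_simps)
  have "0 \<le> t * (t * s - 2 * a)"
    using assms[OF t] by (simp add: a_def s_def power2_eq_square algebra_simps)
  then have "2 * a \<le> t * s" using t by (simp add: zero_le_mult_iff)
  also have "t * s \<le> t * \<bar>s\<bar>" using t by (intro mult_left_mono) auto
  also have "t * \<bar>s\<bar> \<le> a"
    using \<open>a > 0\<close> by (simp add: t_def divide_le_eq)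
  finally show False using \<open>a > 0\<close> by simp
qed

section \<open>Translations and a minimum principle\<close>

context group
begin

lemma indicator_l_coset:
  assumes "g \<in> carrier G" "A \<subseteq> carrier G" "x \<in> carrier G"
  shows "indicator (g <# A) x = (indicator A (inv g \<otimes> x) :: real)"
proof -
  have "x \<in> g <# A \<longleftrightarrow> inv g \<otimes> x \<in> A"
    using assms unfolding l_coset_def
    by (auto simp: subset_iff m_assoc[symmetric] intro!: bexI[of _ "inv g \<otimes> x"])
  then show ?thesis by (simp add: indicator_def)
qed

text \<open>Two steps compose because \<open>inv (s \<otimes> t) = inv t \<otimes> inv s\<close>.
  For a nondegenerate support, a nonempty such \<open>V\<close> is the whole group.\<close>

lemma semigroup_generated_translate:
  assumes "s \<in> semigroup_generated G S" "S \<subseteq> carrier G"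
    and "\<And>g x. g \<in> S \<Longrightarrow> x \<in> V \<Longrightarrow> inv g \<otimes> x \<in> V" and "V \<subseteq> carrier G"
  shows "x \<in> V \<Longrightarrow> inv s \<otimes> x \<in> V"
proof -
  have "s \<in> carrier G \<and> (\<forall>x\<in>V. inv s \<otimes> x \<in> V)"
    using assms(1)
  proof induction
    case (base s)
    then show ?case using assms by auto
  next
    case (mult s t)
    then show ?case using assms(4)
      by (auto simp: inv_mult_group m_assoc subset_iff)
  qed
  then show "x \<in> V \<Longrightarrow> inv s \<otimes> x \<in> V" by blast
qed

text \<open>A minimum principle: \<open>f\<close> cannot attain its infimum approximately inside \<open>U\<close>, so \<open>f\<close> is
  nonnegative; then the complement of \<open>U\<close> is closed under the random walk, hence empty.\<close>

lemma no_strictly_superharmonic: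
  fixes f :: "'a \<Rightarrow> real"
  assumes dist: "distribution_on G \<mu>" and fin: "finite (set_pmf \<mu>)" and nd: "nondegenerate G \<mu>"
    and U: "U \<subseteq> carrier G" "U \<noteq> {}"
    and bdd: "bdd_below (f ` carrier G)"
    and off: "\<And>x. x \<in> carrier G - U \<Longrightarrow> f x = 0"
    and off': "\<And>x. x \<in> carrier G - U \<Longrightarrow> (\<Sum>g\<in>set_pmf \<mu>. pmf \<mu> g * f (inv g \<otimes> x)) = 0"
    and "\<epsilon> > 0"
    and drift: "\<And>x. x \<in> U \<Longrightarrow> f x \<ge> (\<Sum>g\<in>set_pmf \<mu>. pmf \<mu> g * f (inv g \<otimes> x)) + \<epsilon>"
  shows False
proof -
  define c where "c = Inf (f ` carrier G)"
  have S: "set_pmf \<mu> \<subseteq> carrier G" using dist by (simp add: distribution_on_def)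
  have c_le: "c \<le> f x" if "x \<in> carrier G" for x
    unfolding c_def using bdd that by (intro cInf_lower) auto
  have "c \<le> (\<Sum>g\<in>set_pmf \<mu>. pmf \<mu> g * f (inv g \<otimes> x))" if "x \<in> carrier G" for x
  proof -
    have "c = (\<Sum>g\<in>set_pmf \<mu>. pmf \<mu> g * c)"
      using sum_pmf_eq_1[OF fin subset_refl] by (simp add: sum_distrib_right[symmetric])
    also have "\<dots> \<le> (\<Sum>g\<in>set_pmf \<mu>. pmf \<mu> g * f (inv g \<otimes> x))"
      using S that by (intro sum_mono mult_left_mono c_le) auto
    finally show ?thesis .
  qed
  then have inU: "c + \<epsilon> \<le> f x" if "x \<in> U" for x
    using drift[OF that] subsetD[OF U(1) that] by (meson add_mono order_refl order_trans)
  have approx: "\<exists>x\<in>carrier G. f x < c + d" if "d > 0" for d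
    using cInf_lessD[of "f ` carrier G" "c + d"] that U unfolding c_def by auto
  have outside: "carrier G - U \<noteq> {}"
    using approx[OF \<open>\<epsilon> > 0\<close>] inU by force
  have "c \<ge> 0"
  proof (rule ccontr)
    assume "\<not> c \<ge> 0"
    then obtain x where x: "x \<in> carrier G" "f x < c + min \<epsilon> (- c)"
      \<comment> \<open>A value below \<open>c + \<epsilon>\<close> excludes \<open>U\<close>, and a
        negative value excludes the complement, where \<open>f\<close> vanishes.\<close>
      using approx[of "min \<epsilon> (- c)"] \<open>\<epsilon> > 0\<close> by auto
    then show False using inU[of x] off[of x] by (cases "x \<in> U") auto
  qed
  then have pos: "f x > 0" if "x \<in> U" for x using inU[OF that] \<open>\<epsilon> > 0\<close> by linarith
  have nonneg: "f x \<ge> 0" if "x \<in> carrier G" for x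
    using c_le[OF that] \<open>c \<ge> 0\<close> by linarith
  have step: "inv g \<otimes> x \<in> carrier G - U" if g: "g \<in> set_pmf \<mu>" and x: "x \<in> carrier G - U" for g x
  proof -
    \<comment> \<open>A vanishing average of nonnegative terms forces every term to vanish, whereas
      \<open>f\<close> is positive on \<open>U\<close>.\<close>
    have "\<forall>h\<in>set_pmf \<mu>. pmf \<mu> h * f (inv h \<otimes> x) = 0"
      using off'[OF x] x S nonneg by (subst (asm) sum_nonneg_eq_0_iff[OF fin]) auto
    then have "f (inv g \<otimes> x) = 0" using g by (auto simp: set_pmf_iff)
    then show ?thesis using pos[of "inv g \<otimes> x"] g x S by auto
  qed
  obtain x y where x: "x \<in> carrier G - U" and y: "y \<in> U" using outside U by blast
  \<comment> \<open>The inverse of this element translates \<open>x\<close> to \<open>y\<close>, so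
    the walk would lead from outside \<open>U\<close> into \<open>U\<close>.\<close>
  have "x \<otimes> inv y \<in> semigroup_generated G (set_pmf \<mu>)"
    using nd x y U by (auto simp: nondegenerate_def)
  then have "inv (x \<otimes> inv y) \<otimes> x \<in> carrier G - U"
    by (rule semigroup_generated_translate) (use S step x in auto)
  moreover have "inv (x \<otimes> inv y) \<otimes> x = y"
    using x y U by (auto simp: inv_mult_group m_assoc subset_iff)
  ultimately show False using y by simp
qed

section \<open>Existence of a stationary probability on one set\<close>

lemma ex_fin_additive_probability_stationary_finite:
  assumes dist: "distribution_on G \<mu>" and fin: "finite (set_pmf \<mu>)" and nd: "nondegenerate G \<mu>"
    and U: "U \<subseteq> carrier G" "U \<noteq> {}"
    and "finite \<A>"
    and sub: "\<And>A. A \<in> \<A> \<Longrightarrow> A \<subseteq> U" "\<And>A g. A \<in> \<A> \<Longrightarrow> g \<in> set_pmf \<mu> \<Longrightarrow> g <# A \<subseteq> U"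
  shows "\<exists>m\<in>PiE UNIV (\<lambda>_. {0..1}) \<inter> {m. fin_additive_probability U m}.
           \<forall>A\<in>\<A>. (\<Sum>g\<in>set_pmf \<mu>. pmf \<mu> g * m (g <# A)) = m A"
proof -
  have S: "set_pmf \<mu> \<subseteq> carrier G" using dist by (simp add: distribution_on_def)
  define K :: "('a set \<Rightarrow> real) set"
    where "K = PiE UNIV (\<lambda>_. {0..1}) \<inter> {m. fin_additive_probability U m}"
  define err where "err m A = m A - (\<Sum>g\<in>set_pmf \<mu>. pmf \<mu> g * m (g <# A))"
    for m :: "'a set \<Rightarrow> real" and A
  define Q where "Q m = (\<Sum>A\<in>\<A>. (err m A)\<^sup>2)" for m
  define \<delta> :: "'a \<Rightarrow> 'a set \<Rightarrow> real" where "\<delta> x A = indicator A x" for x A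
  have \<delta>_in: "\<delta> x \<in> K" if "x \<in> U" for x
    using fin_additive_probability_indicator[OF that]
    unfolding K_def \<delta>_def by (auto simp: indicator_def)
  have "continuous_on UNIV Q"
    unfolding Q_def err_def
    by (intro continuous_on_sum continuous_on_power continuous_on_diff continuous_on_mult_left
        continuous_on_product_coordinates)
  then have "continuous_on K Q" by (rule continuous_on_subset) simp
  then obtain m where m: "m \<in> K" and min: "\<And>m'. m' \<in> K \<Longrightarrow> Q m \<le> Q m'"
    using continuous_attains_inf[of K Q] compact_fin_additive_probability[of U] \<delta>_in U
    unfolding K_def by blast
  \<comment> \<open>Errors are affine along segments, so \<open>Q\<close> is quadratic in
    \<open>t\<close> there.\<close>
  have err_eq: "err (\<lambda>A. (1 - t) * m A + t * m' A) A = (1 - t) * err m A + t * err m' A" for t m' A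
    unfolding err_def
    by (simp add: algebra_simps sum.distrib sum_subtractf sum_distrib_left)
  \<comment> \<open>The inner product of the error vectors of \<open>m\<close> and of the point mass
    at \<open>x\<close>; it plays the role of \<open>d\<close> in
    \<open>le_of_quadratic_min\<close>.\<close>
  define D where "D x = (\<Sum>A\<in>\<A>. err m A * err (\<delta> x) A)" for x
  have Q_le_D: "Q m \<le> D x" if x: "x \<in> U" for x
  proof (rule le_of_quadratic_min)
    fix t :: real assume t: "0 < t" "t \<le> 1"
    let ?m = "\<lambda>A. (1 - t) * m A + t * \<delta> x A"
    have "(1 - t) * m A + t * \<delta> x A \<in> {0..1}" for A
      using m \<delta>_in[OF x] t unfolding K_def
      by (auto intro!: convex_bound_le simp: PiE_iff)
    then have "?m \<in> K"
      using m \<delta>_in[OF x] t unfolding K_def by (auto intro!: fin_additive_probability_convex)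
    then have "Q m \<le> Q ?m" by (rule min)
    also have "Q ?m = (1 - t)\<^sup>2 * Q m + 2 * t * (1 - t) * D x + t\<^sup>2 * Q (\<delta> x)"
      unfolding Q_def D_def err_eq sum_distrib_left sum.distrib[symmetric]
      by (intro sum.cong refl) (simp add: power2_eq_square algebra_simps)
    finally show "Q m \<le> (1 - t)\<^sup>2 * Q m + 2 * t * (1 - t) * D x + t\<^sup>2 * Q (\<delta> x)" .
  qed
  define f where "f x = (\<Sum>A\<in>\<A>. err m A * indicator A x)" for x
  \<comment> \<open>The error of the point mass at \<open>x\<close> on \<open>A\<close> is the value
    at \<open>x\<close> of the indicator of \<open>A\<close> minus its \<open>\<mu>\<close>-average;
    summing with weights \<open>err m A\<close> gives \<open>f\<close>.\<close>
  have drift: "f x - (\<Sum>g\<in>set_pmf \<mu>. pmf \<mu> g * f (inv g \<otimes> x)) = D x" if x: "x \<in> carrier G" for x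
  proof -
    have "(\<Sum>g\<in>set_pmf \<mu>. pmf \<mu> g * f (inv g \<otimes> x))
        = (\<Sum>g\<in>set_pmf \<mu>. \<Sum>A\<in>\<A>. err m A * (pmf \<mu> g * \<delta> x (g <# A)))"
    proof (rule sum.cong[OF refl])
      fix g assume g: "g \<in> set_pmf \<mu>"
      have "indicator A (inv g \<otimes> x) = \<delta> x (g <# A)" if "A \<in> \<A>" for A
        using indicator_l_coset[of g A x] S g sub(1)[OF that] U x unfolding \<delta>_def
        by (metis subset_iff)
      then show "pmf \<mu> g * f (inv g \<otimes> x) = (\<Sum>A\<in>\<A>. err m A * (pmf \<mu> g * \<delta> x (g <# A)))"
        unfolding f_def sum_distrib_left by (intro sum.cong) auto
    qed
    also have "\<dots> = (\<Sum>A\<in>\<A>. err m A * (\<Sum>g\<in>set_pmf \<mu>. pmf \<mu> g * \<delta> x (g <# A)))"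
      unfolding sum_distrib_left by (rule sum.swap)
    finally show ?thesis
      unfolding f_def D_def err_def[of "\<delta> x"] by (simp add: \<delta>_def right_diff_distrib sum_subtractf)
  qed
  have f_off: "f x = 0" if "x \<notin> U" for x
    unfolding f_def using sub(1) that by (intro sum.neutral) (auto simp: indicator_def)
  have D_off: "D x = 0" if "x \<notin> U" for x
  proof -
    \<comment> \<open>A point outside \<open>U\<close> lies neither in \<open>A\<close> nor in any
      of its translates by the support.\<close>
    have "err (\<delta> x) A = 0" if "A \<in> \<A>" for A
      using sub(1)[OF that] sub(2)[OF that] \<open>x \<notin> U\<close>
      unfolding err_def \<delta>_def by (auto simp: indicator_def subset_iff intro!: sum.neutral)
    then show ?thesis unfolding D_def by simp
  qed
  have "Q m = 0"
  proof (rule ccontr)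
    assume "Q m \<noteq> 0"
    then have pos: "Q m > 0"
      unfolding Q_def by (metis sum_nonneg zero_le_power2 less_eq_real_def)
    have "- (\<Sum>A\<in>\<A>. \<bar>err m A\<bar>) \<le> f x" for x
      unfolding f_def sum_negf[symmetric] by (intro sum_mono) (auto simp: indicator_def)
    then have bdd: "bdd_below (f ` carrier G)" by (intro bdd_belowI2)
    show False
    proof (rule no_strictly_superharmonic[OF dist fin nd U bdd _ _ pos])
      fix x assume x: "x \<in> U"
      then show "(\<Sum>g\<in>set_pmf \<mu>. pmf \<mu> g * f (inv g \<otimes> x)) + Q m \<le> f x"
        using drift[of x] Q_le_D[OF x] U by fastforce
    next
      fix x assume x: "x \<in> carrier G - U"
      then show "f x = 0" using f_off by auto
      show "(\<Sum>g\<in>set_pmf \<mu>. pmf \<mu> g * f (inv g \<otimes> x)) = 0"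
        using drift[of x] D_off[of x] f_off[of x] x by auto
    qed
  qed
  then have "err m A = 0" if "A \<in> \<A>" for A
    using that \<open>finite \<A>\<close> unfolding Q_def by (simp add: sum_nonneg_eq_0_iff)
  then show ?thesis using m unfolding K_def err_def by (intro bexI[of _ m]) auto
qed

lemma ex_fin_additive_probability_stationary:
  assumes dist: "distribution_on G \<mu>" and fin: "finite (set_pmf \<mu>)" and nd: "nondegenerate G \<mu>"
    and U: "U \<subseteq> carrier G" "U \<noteq> {}"
  shows "\<exists>m. fin_additive_probability U m \<and> stationary_on G \<mu> U m"
proof -
  define \<A> where "\<A> = {A. A \<subseteq> U \<and> (\<forall>g\<in>set_pmf \<mu>. g <# A \<subseteq> U)}"
  define Z where "Z A = {m. (\<Sum>g\<in>set_pmf \<mu>. pmf \<mu> g * m (g <# A)) = m A}" for A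
  \<comment> \<open>Finite intersection property, with one closed set \<open>Z A\<close> per
    instance of stationarity.\<close>
  have "(PiE UNIV (\<lambda>_. {0..1}) \<inter> {m. fin_additive_probability U m}) \<inter> (\<Inter>A\<in>\<A>. Z A) \<noteq> {}"
  proof (rule compact_imp_fip_image[OF compact_fin_additive_probability])
    fix A show "closed (Z A)"
      unfolding Z_def by (intro closed_Collect_eq continuous_on_sum
          continuous_on_mult_left continuous_on_product_coordinates)
  next
    fix \<B> assume "finite \<B>" "\<B> \<subseteq> \<A>"
    then have "\<exists>m\<in>PiE UNIV (\<lambda>_. {0..1}) \<inter> {m. fin_additive_probability U m}.
        \<forall>A\<in>\<B>. (\<Sum>g\<in>set_pmf \<mu>. pmf \<mu> g * m (g <# A)) = m A"
      by (intro ex_fin_additive_probability_stationary_finite[OF dist fin nd U])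
        (auto simp: \<A>_def)
    then obtain m where "m \<in> PiE UNIV (\<lambda>_. {0..1}) \<inter> {m. fin_additive_probability U m}"
      and "\<forall>A\<in>\<B>. m \<in> Z A"
      unfolding Z_def by blast
    then show "(PiE UNIV (\<lambda>_. {0..1}) \<inter> {m. fin_additive_probability U m}) \<inter> (\<Inter>A\<in>\<B>. Z A) \<noteq> {}"
      by blast
  qed
  then obtain m where "fin_additive_probability U m" and Z: "\<And>A. A \<in> \<A> \<Longrightarrow> m \<in> Z A"
    by auto
  moreover have "stationary_on G \<mu> U m"
    using Z unfolding \<A>_def Z_def stationary_on_def by simp
  ultimately show ?thesis by blast
qed

section \<open>Finite families of conditioning sets\<close>

text \<open>The sets in \<open>\<F>\<close> charged by a stationary probability on \<open>\<Union>\<F>\<close> are handled by that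
  probability; the null ones form a strictly smaller family, and any member of it is negligible
  inside every charged set.\<close>

lemma ex_stationary_conditional_probability_finite:
  assumes dist: "distribution_on G \<mu>" and fin: "finite (set_pmf \<mu>)" and nd: "nondegenerate G \<mu>"
    and "finite \<F>" "\<And>B. B \<in> \<F> \<Longrightarrow> B \<subseteq> carrier G \<and> B \<noteq> {}"
  shows "\<exists>P. (\<forall>B\<in>\<F>. fin_additive_probability B (\<lambda>A. P A B) \<and> stationary_on G \<mu> B (\<lambda>A. P A B)) \<and>
             (\<forall>A. \<forall>B\<in>\<F>. \<forall>C\<in>\<F>. A \<subseteq> B \<and> B \<subseteq> C \<longrightarrow> P A B * P B C = P A C)"
  using assms(4,5)
proof (induction \<F> rule: finite_psubset_induct)
  case (psubset \<F>)
  show ?case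
  proof (cases "\<F> = {}")
    case True
    then show ?thesis by simp
  next
    case False
    then have U: "\<Union>\<F> \<subseteq> carrier G" "\<Union>\<F> \<noteq> {}" using psubset.prems by blast+
    obtain m where m: "fin_additive_probability (\<Union>\<F>) m" and st: "stationary_on G \<mu> (\<Union>\<F>) m"
      using ex_fin_additive_probability_stationary[OF dist fin nd U] by blast
    define \<N> where "\<N> = {B\<in>\<F>. m B = 0}"
    \<comment> \<open>A finite union of null sets is null, but the whole union has mass
      \<open>1\<close>; so the recursion descends.\<close>
    have "\<N> \<noteq> \<F>"
    proof
      assume "\<N> = \<F>"
      then have "m (\<Union>\<F>) = 0"
        by (intro fin_additive_probability_Union_null[OF m] psubset.hyps) (auto simp: \<N>_def)
      then show False using m by (simp add: fin_additive_probability_def)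
    qed
    then have \<N>: "\<N> \<subset> \<F>" by (auto simp: \<N>_def)
    have "\<exists>P. (\<forall>B\<in>\<N>. fin_additive_probability B (\<lambda>A. P A B) \<and> stationary_on G \<mu> B (\<lambda>A. P A B)) \<and>
             (\<forall>A. \<forall>B\<in>\<N>. \<forall>C\<in>\<N>. A \<subseteq> B \<and> B \<subseteq> C \<longrightarrow> P A B * P B C = P A C)"
      by (rule psubset.IH[OF \<N>]) (use psubset.prems \<N> in blast)
    then obtain P where
      P: "\<forall>B\<in>\<N>. fin_additive_probability B (\<lambda>A. P A B) \<and> stationary_on G \<mu> B (\<lambda>A. P A B)"
      and mult: "\<forall>A. \<forall>B\<in>\<N>. \<forall>C\<in>\<N>. A \<subseteq> B \<and> B \<subseteq> C \<longrightarrow> P A B * P B C = P A C"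
      by (elim exE conjE)
    define R where "R A B = (if m B = 0 then P A B else m A / m B)" for A B
    have mono: "m A \<le> m B" if "A \<subseteq> B" "B \<in> \<F>" for A B
      using that by (intro fin_additive_probability_mono[OF m]) auto
    have nonneg: "0 \<le> m A" if "A \<subseteq> B" "B \<in> \<F>" for A B
      using that by (intro fin_additive_probability_nonneg[OF m]) auto
    have "fin_additive_probability B (\<lambda>A. R A B) \<and> stationary_on G \<mu> B (\<lambda>A. R A B)"
      if B: "B \<in> \<F>" for B
    proof (cases "m B = 0")
      case True
      then show ?thesis using P B by (simp add: R_def \<N>_def)
    next
      case nz: False
      then have pos: "m B > 0" using nonneg[of B B] B by auto
      have "fin_additive_probability B (\<lambda>A. m A / m B)"
        unfolding fin_additive_probability_def
      proof (intro conjI allI impI)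
        fix A assume "A \<subseteq> B"
        then show "m A / m B \<in> {0..1}" using mono[of A B] nonneg[of A B] B pos by simp
      next
        fix A A' assume "A \<subseteq> B \<and> A' \<subseteq> B \<and> A \<inter> A' = {}"
        then have "m (A \<union> A') = m A + m A'"
          using B by (intro fin_additive_probability_Un[OF m]) auto
        then show "m (A \<union> A') / m B = m A / m B + m A' / m B" by (simp add: add_divide_distrib)
      qed (use pos in simp)
      moreover have "stationary_on G \<mu> B (\<lambda>A. m A / m B)"
        unfolding stationary_on_def
      proof (intro allI impI)
        fix A assume A: "A \<subseteq> B \<and> (\<forall>g\<in>set_pmf \<mu>. g <# A \<subseteq> B)"
        \<comment> \<open>An instance of stationarity inside \<open>B\<close> is also one inside the
          larger union.\<close>
        then have "A \<subseteq> \<Union>\<F> \<and> (\<forall>g\<in>set_pmf \<mu>. g <# A \<subseteq> \<Union>\<F>)"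
          using B by (meson Union_upper order_trans)
        then have "(\<Sum>g\<in>set_pmf \<mu>. pmf \<mu> g * m (g <# A)) = m A"
          using st unfolding stationary_on_def by blast
        then show "(\<Sum>g\<in>set_pmf \<mu>. pmf \<mu> g * (m (g <# A) / m B)) = m A / m B"
          by (simp add: sum_divide_distrib[symmetric])
      qed
      ultimately show ?thesis using nz by (simp add: R_def)
    qed
    moreover have "R A B * R B C = R A C" if "B \<in> \<F>" "C \<in> \<F>" "A \<subseteq> B" "B \<subseteq> C" for A B C
    proof -
      \<comment> \<open>If \<open>m C = 0\<close>, both conditioning sets are null and
        \<open>P\<close> applies; if only \<open>m B = 0\<close>, both sides are \<open>0\<close>;
        otherwise \<open>m B\<close> cancels.\<close>
      have "0 \<le> m A" "m A \<le> m B" "m B \<le> m C"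
        using that nonneg[of A B] mono[of A B] mono[of B C] by auto
      then show ?thesis
        using mult that by (auto simp: R_def \<N>_def)
    qed
    ultimately show ?thesis by blast
  qed
qed

end

section \<open>All conditioning sets at once\<close>

theorem theorem2:
  fixes G :: "('a, 'b) monoid_scheme" and \<mu> :: "'a pmf"
  assumes "group G"
    and "distribution_on G \<mu>"
    and "finite (set_pmf \<mu>)"
    and "nondegenerate G \<mu>"
  shows "\<exists>P. conditional_probability (carrier G) P \<and> stationary G \<mu> P"
proof -
  define \<N> where "\<N> = {B. B \<subseteq> carrier G \<and> B \<noteq> {}}"
  \<comment> \<open>A candidate is a point of the cube indexed by pairs \<open>(A, B)\<close>.
    Constraints are indexed by two conditioning sets because multiplicativity links \<open>B\<close>
    and \<open>C\<close>.\<close>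
  define Z :: "'a set \<times> 'a set \<Rightarrow> ('a set \<times> 'a set \<Rightarrow> real) set" where
    "Z = (\<lambda>(B, C). ((\<lambda>p A. p (A, B)) -` {m. fin_additive_probability B m}) \<inter>
      ((\<lambda>p A. p (A, B)) -` {m. stationary_on G \<mu> B m}) \<inter>
      {p. \<forall>A. A \<subseteq> B \<and> B \<subseteq> C \<longrightarrow> p (A, B) * p (B, C) = p (A, C)})"
  have "PiE UNIV (\<lambda>_. {0..1}) \<inter> (\<Inter>i\<in>\<N> \<times> \<N>. Z i) \<noteq> {}"
  proof (rule compact_imp_fip_image[OF compact_unit_cube])
    fix i :: "'a set \<times> 'a set"
    obtain B C where i: "i = (B, C)" by (cases i)
    have cont: "continuous_on UNIV (\<lambda>(p :: 'a set \<times> 'a set \<Rightarrow> real) A. p (A, B))"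
      by (intro continuous_on_coordinatewise_then_product continuous_on_product_coordinates)
    have "closed {p :: 'a set \<times> 'a set \<Rightarrow> real.
        \<forall>A. A \<subseteq> B \<and> B \<subseteq> C \<longrightarrow> p (A, B) * p (B, C) = p (A, C)}"
      by (intro closed_Collect_all closed_Collect_const_imp closed_Collect_eq
          continuous_on_mult continuous_on_product_coordinates)
    then show "closed (Z i)"
      unfolding Z_def i prod.case
      by (intro closed_Int closed_vimage[OF _ cont] closed_fin_additive_probability
          closed_stationary_on)
  next
    fix I assume I: "finite I" "I \<subseteq> \<N> \<times> \<N>"
    \<comment> \<open>The conditioning sets occurring in the finitely many chosen
      constraints.\<close>
    define \<F> where "\<F> = fst ` I \<union> snd ` I"
    have "finite \<F>" "\<And>B. B \<in> \<F> \<Longrightarrow> B \<subseteq> carrier G \<and> B \<noteq> {}"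
      using I by (force simp: \<F>_def \<N>_def)+
    then have "\<exists>P. (\<forall>B\<in>\<F>. fin_additive_probability B (\<lambda>A. P A B) \<and> stationary_on G \<mu> B (\<lambda>A. P A B)) \<and>
             (\<forall>A. \<forall>B\<in>\<F>. \<forall>C\<in>\<F>. A \<subseteq> B \<and> B \<subseteq> C \<longrightarrow> P A B * P B C = P A C)"
      by (rule group.ex_stationary_conditional_probability_finite[OF assms])
    then obtain P where
      P: "\<forall>B\<in>\<F>. fin_additive_probability B (\<lambda>A. P A B) \<and> stationary_on G \<mu> B (\<lambda>A. P A B)"
      and mult: "\<forall>A. \<forall>B\<in>\<F>. \<forall>C\<in>\<F>. A \<subseteq> B \<and> B \<subseteq> C \<longrightarrow> P A B * P B C = P A C"
      by (elim exE conjE)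
    \<comment> \<open>\<open>P\<close> is uncontrolled at other pairs; the default \<open>0\<close>
      keeps \<open>p\<close> in the cube.\<close>
    define p where "p = (\<lambda>(A, B). if A \<subseteq> B \<and> B \<in> \<F> then P A B else 0)"
    have "p \<in> PiE UNIV (\<lambda>_. {0..1})"
      using P unfolding p_def fin_additive_probability_def by (auto simp: PiE_iff)
    moreover have "p \<in> Z (B, C)" if "(B, C) \<in> I" for B C
    proof -
      have B: "B \<in> \<F>" and C: "C \<in> \<F>" using that by (force simp: \<F>_def)+
      have "fin_additive_probability B (\<lambda>A. p (A, B))"
        using P B by (subst fin_additive_probability_cong[of B _ "\<lambda>A. P A B"]) (auto simp: p_def B)
      moreover have "stationary_on G \<mu> B (\<lambda>A. p (A, B))"
        using P B by (subst stationary_on_cong[of B _ "\<lambda>A. P A B"]) (auto simp: p_def B)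
      moreover have "p (A, B) * p (B, C) = p (A, C)" if "A \<subseteq> B" "B \<subseteq> C" for A
        using mult that B C by (auto simp: p_def)
      ultimately show ?thesis by (simp add: Z_def)
    qed
    ultimately have "p \<in> PiE UNIV (\<lambda>_. {0..1}) \<inter> (\<Inter>i\<in>I. Z i)" by force
    then show "PiE UNIV (\<lambda>_. {0..1}) \<inter> (\<Inter>i\<in>I. Z i) \<noteq> {}" by blast
  qed
  then obtain p where "\<And>B C. B \<in> \<N> \<Longrightarrow> C \<in> \<N> \<Longrightarrow> p \<in> Z (B, C)" by blast
  then have p: "fin_additive_probability B (\<lambda>A. p (A, B))" "stationary_on G \<mu> B (\<lambda>A. p (A, B))"
    "A \<subseteq> B \<Longrightarrow> B \<subseteq> C \<Longrightarrow> p (A, B) * p (B, C) = p (A, C)"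
    if "B \<in> \<N>" "C \<in> \<N>" for A B C
    using that by (auto simp: Z_def)
  have "conditional_probability (carrier G) (\<lambda>A B. p (A, B))"
    unfolding conditional_probability_def
  proof (intro conjI allI impI)
    fix B assume "B \<subseteq> carrier G \<and> B \<noteq> {}"
    then show "fin_additive_probability B (\<lambda>A. p (A, B))"
      using p(1)[of B B] by (simp add: \<N>_def)
  next
    fix A B C assume *: "A \<subseteq> B \<and> B \<subseteq> C \<and> C \<subseteq> carrier G \<and> B \<noteq> {}"
    then show "p (A, B) * p (B, C) = p (A, C)"
      by (intro p(3)) (auto simp: \<N>_def)
  qed
  moreover have "stationary G \<mu> (\<lambda>A B. p (A, B))"
    using p(2) unfolding stationary_iff_stationary_on[OF assms(2,3)] by (auto simp: \<N>_def)
  ultimately show ?thesis by blast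
qed

end
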